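(* Let $\epsilon<1$ and $c>1$ be constants. Suppose there is an algorithm $\mathcal A_N$ with running time $T_N$ that solves the planted dense subgraph recovery problem $\mathsf{PDSR}(N,K,cq,q,\epsilon)$ with probability $1-\eta_N$. Then there exists a (randomized) test $\phi_N$ with running time at most $N^2+NT_N+NK^2$ that solves the planted dense subgraph detection problem $\mathsf{PDS}(N,2K,cq,q)$ with Type-I+II error probability at most $$\eta_N+e^{-CK}+2N e^{-CK^2q+K\log N},$$ where the constant $C>0$ only depends on $\epsilon$ and $c$.
   Context: Recovery problem. $\widetilde{\mathcal G}(N,K,p,q)$ (with $p>q$) is the planted dense subgraph model with deterministic size: a set $S$ of size $K$ is chosen uniformly at random from $[N]=\{1,\dots,N\}$; given $S$, each pair of vertices is connected independently, with probability $p$ if both are in $S$ and with probability $q$ otherwise. $\mathsf{PDSR}(N,K,p,q,\epsilon)$ is the problem: given a graph generated from $\widetilde{\mathcal G}(N,K,p,q)$, output a set $\widehat S\subset[N]$ of size $K$ such that $|\widehat S\cap S|\ge(1-\epsilon)K$. Detection problem. $\mathcal G(N,q)$ is the Erdős–Rényi random graph on $N$ vertices with edge probability $q$. $\mathcal G(N,K,p,q)$ is the model in which each vertex is included in a random set $S$ independently with probability $K/N$ and, given $S$, each pair of vertices is connected independently, with probability $p$ if both are in $S$ and with probability $q$ otherwise. $\mathsf{PDS}(N,K,p,q)$ is the problem of distinguishing $H_0:G\sim\mathcal G(N,q)$ (law $\mathbb P_0$) from $H_1:G\sim\mathcal G(N,K,p,q)$ (law $\mathbb P_1$); the Type-I+II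 error probability of a test $\phi$ is $\mathbb P_0\{\phi(G)=1\}+\mathbb P_1\{\phi(G)=0\}$. For $\mathsf{PDS}(N,2K,cq,q)$ to make sense one has $2K\le N$ and $cq\le1$. Running times are counted in elementary time units, where re-sampling all the edges incident to one vertex of an $N$-vertex graph costs $N$ time units and counting the edges inside a set of $K$ vertices costs at most $K^2$ time units. *)

theory Defs
  imports "HOL-Probability.Probability" "HOL-Probability.Product_PMF"
begin

text \<open>A simple graph on the vertex set \<open>{1..N}\<close> is the set of its edges, a subset of \<open>vpairs N\<close>.\<close>

type_synonym graph = "nat set set"

definition vpairs :: "nat \<Rightarrow> nat set set" where
  "vpairs N = {e. e \<subseteq> {1..N} \<and> card e = 2}"

definition indep_edges :: "nat set set \<Rightarrow> (nat set \<Rightarrow> real) \<Rightarrow> graph pmf" where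
  "indep_edges E w = map_pmf Collect (Pi_pmf E False (\<lambda>e. bernoulli_pmf (w e)))"

definition erdos_renyi :: "nat \<Rightarrow> real \<Rightarrow> graph pmf" where
  "erdos_renyi N q = indep_edges (vpairs N) (\<lambda>_. q)"

definition planted_graph :: "nat \<Rightarrow> nat set \<Rightarrow> real \<Rightarrow> real \<Rightarrow> graph pmf" where
  "planted_graph N S p q = indep_edges (vpairs N) (\<lambda>e. if e \<subseteq> S then p else q)"

text \<open>Deterministic community size: joint law of the planted set and the graph.\<close>

definition pds_fixed_size :: "nat \<Rightarrow> nat \<Rightarrow> real \<Rightarrow> real \<Rightarrow> (nat set \<times> graph) pmf" where
  "pds_fixed_size N K p q =
     bind_pmf (pmf_of_set {S. S \<subseteq> {1..N} \<and> card S = K})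
       (\<lambda>S. map_pmf (Pair S) (planted_graph N S p q))"

text \<open>Binomial community size: law of the graph only.\<close>

definition pds_random_size :: "nat \<Rightarrow> nat \<Rightarrow> real \<Rightarrow> real \<Rightarrow> graph pmf" where
  "pds_random_size N K p q =
     bind_pmf (map_pmf Collect (Pi_pmf {1..N} False (\<lambda>_. bernoulli_pmf (real K / real N))))
       (\<lambda>S. planted_graph N S p q)"

text \<open>
  A randomized algorithm maps its input to the joint law of its output and of the number of
  time units it spends. No machine model is fixed for the recovery algorithm.
\<close>

type_synonym ('a, 'b) timed_alg = "'a \<Rightarrow> ('b \<times> nat) pmf"

definition runs_within :: "nat \<Rightarrow> (graph, 'b) timed_alg \<Rightarrow> nat \<Rightarrow> bool" where
  "runs_within N A T \<longleftrightarrow> (\<forall>G. G \<subseteq> vpairs N \<longrightarrow> (\<forall>(x, t) \<in> set_pmf (A G). t \<le> T))"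

definition recovery_alg :: "nat \<Rightarrow> nat \<Rightarrow> (graph, nat set) timed_alg \<Rightarrow> bool" where
  "recovery_alg N K A \<longleftrightarrow>
     (\<forall>G. G \<subseteq> vpairs N \<longrightarrow> (\<forall>(S, t) \<in> set_pmf (A G). S \<subseteq> {1..N} \<and> card S = K))"

definition pdsr_success_prob ::
    "nat \<Rightarrow> nat \<Rightarrow> real \<Rightarrow> real \<Rightarrow> real \<Rightarrow> (graph, nat set) timed_alg \<Rightarrow> real" where
  "pdsr_success_prob N K p q \<epsilon> A =
     measure_pmf.prob
       (bind_pmf (pds_fixed_size N K p q)
          (\<lambda>(S, G). map_pmf (\<lambda>(S', t). (S, S')) (A G)))
       {(S, S'). real (card (S' \<inter> S)) \<ge> (1 - \<epsilon>) * real K}"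

definition edges_inside :: "nat set \<Rightarrow> graph \<Rightarrow> nat" where
  "edges_inside S G = card {e \<in> G. e \<subseteq> S}"

definition resample_vertex :: "nat \<Rightarrow> real \<Rightarrow> nat \<Rightarrow> graph \<Rightarrow> graph pmf" where
  "resample_vertex N q v G =
     map_pmf (\<lambda>H. {e \<in> G. v \<notin> e} \<union> H) (indep_edges {e \<in> vpairs N. v \<in> e} (\<lambda>_. q))"

text \<open>
  Programs for tests that may call a recovery algorithm \<open>A\<close>. A program works on a current
  graph, initially the observed one, and a current vertex set, initially empty.
  \<open>Resample v\<close> redraws all edges at \<open>v\<close> and costs \<open>N\<close> time units; \<open>Recover\<close> runs \<open>A\<close> on (a
  copy of) the current graph with fresh randomness, stores its output as the current vertex set
  and costs what \<open>A\<close> spends; \<open>IfEdges m P Q\<close> counts the edges inside the current vertex set and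
  branches on whether there are at least \<open>m\<close>, at the cost of the squared size of the set.
  These are the only ways to access the graph: unit-cost access to single edges together with
  free control flow would put every test within time \<open>N\<^sup>2\<close>.
\<close>

datatype test_prog =
    Answer bool
  | Resample nat test_prog
  | Recover test_prog
  | IfEdges nat test_prog test_prog

definition spend :: "nat \<Rightarrow> ('b \<times> nat) pmf \<Rightarrow> ('b \<times> nat) pmf" where
  "spend s M = map_pmf (\<lambda>(x, t). (x, s + t)) M"

primrec exec_prog ::
    "nat \<Rightarrow> real \<Rightarrow> (graph, nat set) timed_alg \<Rightarrow> test_prog \<Rightarrow> nat set \<Rightarrow> (graph, bool) timed_alg"
where
  "exec_prog N q A (Answer b) S G = return_pmf (b, 0)"
| "exec_prog N q A (Resample v P) S G =
     spend N (bind_pmf (resample_vertex N q v G) (\<lambda>G'. exec_prog N q A P S G'))"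
| "exec_prog N q A (Recover P) S G =
     bind_pmf (A G) (\<lambda>(S', t). spend t (exec_prog N q A P S' G))"
| "exec_prog N q A (IfEdges m P Q) S G =
     spend ((card S)\<^sup>2)
       (if m \<le> edges_inside S G then exec_prog N q A P S G else exec_prog N q A Q S G)"

text \<open>A randomized test draws its program at random, independently of the graph.\<close>

definition run_test ::
    "nat \<Rightarrow> real \<Rightarrow> (graph, nat set) timed_alg \<Rightarrow> test_prog pmf \<Rightarrow> (graph, bool) timed_alg" where
  "run_test N q A \<Phi> G = bind_pmf \<Phi> (\<lambda>P. exec_prog N q A P {} G)"

text \<open>Type-I+II error for the null law \<open>erdos_renyi N q\<close> against \<open>pds_random_size N K p q\<close>;
  the answer \<open>True\<close> rejects the null hypothesis.\<close>

definition pds_error :: "nat \<Rightarrow> nat \<Rightarrow> real \<Rightarrow> real \<Rightarrow> (graph, bool) timed_alg \<Rightarrow> real" where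
  "pds_error N K p q \<phi> =
     measure_pmf.prob (bind_pmf (erdos_renyi N q) \<phi>) {(b, t). b}
   + measure_pmf.prob (bind_pmf (pds_random_size N K p q) \<phi>) {(b, t). \<not> b}"

end

theory Submission imports Defs begin

text \<open>
  The test draws a uniformly random order of the vertices and resamples them one at a time. Before
  each resampling it runs the recovery algorithm and rejects as soon as the returned \<open>K\<close>-set
  contains atypically many edges.

  Resampling leaves the null law invariant, so a false rejection forces one of at most \<open>N\<close>
  Erdos-Renyi graphs to contain some dense \<open>K\<close>-set, which a Chernoff and union bound excludes.
  Under the alternative the planted set loses one vertex at a time; it starts with at least \<open>K\<close>
  vertices up to probability \<open>exp (- C K)\<close>, hence at some time has exactly \<open>K\<close>, and by symmetry
  it is then uniform. At that moment the graph follows the fixed-size model, so the algorithm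
  succeeds up to probability \<open>\<eta>\<close>, and every \<open>K\<close>-set overlapping the planted set well is dense.

  If \<open>K\<close> is bounded in terms of \<open>\<epsilon>\<close>, the claimed error bound exceeds 1 and a constant test works.
\<close>

section \<open>Chernoff bounds for random subsets\<close>

lemma measure_bind_pmf_eq_integral:
  "measure_pmf.prob (bind_pmf M f) X = (\<integral>x. measure_pmf.prob (f x) X \<partial>measure_pmf M)"
proof -
  have *: "measure_pmf.prob L X = pmf (map_pmf (\<lambda>x. x \<in> X) L) True" for L
    by (simp add: pmf_map vimage_def)
  show ?thesis
    unfolding * map_bind_pmf pmf_bind ..
qed

lemma integrable_pmf_bounded:
  fixes f :: "'a \<Rightarrow> real"
  assumes "\<And>x. \<bar>f x\<bar> \<le> B"
  shows "integrable (measure_pmf M) f"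
  by (rule measure_pmf.integrable_const_bound[of _ B]) (use assms in auto)

text \<open>The encoding of \<open>indep_edges\<close> over an arbitrary ground set, so that one
  Chernoff bound serves both the edge counts and the size of the binomial community.\<close>

abbreviation random_subset :: "'a set \<Rightarrow> ('a \<Rightarrow> real) \<Rightarrow> 'a set pmf" where
  "random_subset E w \<equiv> map_pmf Collect (Pi_pmf E False (\<lambda>e. bernoulli_pmf (w e)))"

lemma set_Pi_pmf_False_subset:
  assumes "finite E" "f \<in> set_pmf (Pi_pmf E False p)"
  shows "Collect f \<subseteq> E"
  using assms(2) set_Pi_pmf_subset[OF assms(1), of False p] by blast

lemma set_pmf_random_subset:
  assumes "finite E" "G \<in> set_pmf (random_subset E w)"
  shows "G \<subseteq> E"
  using assms(2) set_Pi_pmf_False_subset[OF assms(1)] by force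

lemma random_subset_cong:
  assumes "\<And>e. e \<in> E \<Longrightarrow> w e = w' e"
  shows "random_subset E w = random_subset E w'"
  using assms by (intro arg_cong[where f = "map_pmf Collect"] Pi_pmf_cong) auto

lemma random_subset_Int:
  assumes "finite E" "F \<subseteq> E"
  shows "map_pmf (\<lambda>G. G \<inter> F) (random_subset E w) = random_subset F w"
  unfolding Pi_pmf_subset[OF assms] pmf.map_comp
  by (intro map_pmf_cong) auto

lemma random_subset_Un:
  assumes "finite E" "finite F" "E \<inter> F = {}"
  shows "random_subset (E \<union> F) w =
    bind_pmf (random_subset E w) (\<lambda>G. map_pmf (\<lambda>H. G \<union> H) (random_subset F w))"
proof -
  have "random_subset (E \<union> F) w =
      map_pmf (\<lambda>(f, g). Collect f \<union> Collect g)
        (pair_pmf (Pi_pmf E False (\<lambda>e. bernoulli_pmf (w e))) (Pi_pmf F False (\<lambda>e. bernoulli_pmf (w e))))"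
    unfolding Pi_pmf_union[OF assms] pmf.map_comp
  proof (intro map_pmf_cong refl)
    fix x
    assume "x \<in> set_pmf (pair_pmf (Pi_pmf E False (\<lambda>e. bernoulli_pmf (w e)))
      (Pi_pmf F False (\<lambda>e. bernoulli_pmf (w e))))"
    then have "fst x \<in> set_pmf (Pi_pmf E False (\<lambda>e. bernoulli_pmf (w e)))"
      "snd x \<in> set_pmf (Pi_pmf F False (\<lambda>e. bernoulli_pmf (w e)))"
      unfolding set_pair_pmf by (auto simp only: mem_Times_iff)
    then have "Collect (fst x) \<subseteq> E" "Collect (snd x) \<subseteq> F"
      using set_Pi_pmf_False_subset[OF assms(1)] set_Pi_pmf_False_subset[OF assms(2)] by blast+
    then show "(Collect \<circ> (\<lambda>(f, g) x. if x \<in> E then f x else g x)) x =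
        (case x of (f, g) \<Rightarrow> Collect f \<union> Collect g)"
      using assms(3) by (auto simp: split_beta)
  qed
  also have "\<dots> = bind_pmf (random_subset E w) (\<lambda>G. map_pmf (\<lambda>H. G \<union> H) (random_subset F w))"
    by (simp only: pair_pmf_def map_pmf_def bind_assoc_pmf bind_return_pmf case_prod_conv)
  finally show ?thesis .
qed

text \<open>The count depends only on \<open>G \<inter> F\<close>, which is again a product law. The
  exponential of the count is a product over \<open>F\<close>, so independence factorizes its
  expectation, and \<open>1 + x \<le> exp x\<close> bounds each factor.\<close>

lemma random_subset_mgf_le:
  assumes E: "finite E" and F: "F \<subseteq> E" and w: "\<And>e. e \<in> F \<Longrightarrow> 0 \<le> w e \<and> w e \<le> 1"
  shows "integrable (random_subset E w) (\<lambda>G. exp (l * real (card (G \<inter> F))))"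
    and "(\<integral>G. exp (l * real (card (G \<inter> F))) \<partial>random_subset E w) \<le> exp ((exp l - 1) * (\<Sum>e\<in>F. w e))"
proof -
  have finF: "finite F" using E F finite_subset by blast
  have eq: "exp (l * real (card (G \<inter> F))) = (\<Prod>e\<in>F. if e \<in> G then exp l else 1)" for G
    using finF by (simp add: prod.If_cases Int_commute exp_of_nat_mult[symmetric] mult.commute)
  have int: "integrable (random_subset F w) (\<lambda>G. exp (l * real (card (G \<inter> F))))"
    unfolding eq by (simp, intro integrable_prod_Pi_pmf finF integrable_measure_pmf_finite) auto
  have int': "(\<integral>G. exp (l * real (card (G \<inter> F))) \<partial>random_subset F w)
     = (\<Prod>e\<in>F. 1 + w e * (exp l - 1))"
  proof -
    have "(\<integral>G. exp (l * real (card (G \<inter> F))) \<partial>random_subset F w) =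
      (\<Prod>e\<in>F. (\<integral>b. (if b then exp l else 1) \<partial>bernoulli_pmf (w e)))"
      unfolding eq integral_map_pmf mem_Collect_eq
      by (rule expectation_prod_Pi_pmf[OF finF]) (auto intro: integrable_measure_pmf_finite)
    also have "\<dots> = (\<Prod>e\<in>F. 1 + w e * (exp l - 1))"
      using w by (intro prod.cong refl) (simp add: algebra_simps)
    finally show ?thesis .
  qed
  have "(\<Prod>e\<in>F. 1 + w e * (exp l - 1)) \<le> (\<Prod>e\<in>F. exp (w e * (exp l - 1)))"
  proof (intro prod_mono conjI exp_ge_add_one_self)
    fix e assume "e \<in> F"
    \<comment> \<open>As a convex combination of \<open>1\<close> and \<open>exp l\<close>, each
      factor is nonnegative for either sign of \<open>l\<close>, as the comparison of products
      requires.\<close>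
    then have "0 \<le> (1 - w e) + w e * exp l" using w by (intro add_nonneg_nonneg mult_nonneg_nonneg) auto
    then show "0 \<le> 1 + w e * (exp l - 1)" by (simp add: algebra_simps)
  qed
  also have "\<dots> = exp ((exp l - 1) * (\<Sum>e\<in>F. w e))"
    using finF by (simp add: exp_sum[symmetric] sum_distrib_right mult.commute)
  finally have le: "(\<integral>G. exp (l * real (card (G \<inter> F))) \<partial>random_subset F w) \<le> \<dots>" unfolding int' .
  show "integrable (random_subset E w) (\<lambda>G. exp (l * real (card (G \<inter> F))))"
    using int unfolding random_subset_Int[OF E F, symmetric]
    by (subst (asm) integrable_map_pmf_eq) (simp add: Int_assoc)
  show "(\<integral>G. exp (l * real (card (G \<inter> F))) \<partial>random_subset E w) \<le> exp ((exp l - 1) * (\<Sum>e\<in>F. w e))"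
    using le unfolding random_subset_Int[OF E F, symmetric]
    by (subst (asm) integral_map_pmf) (simp add: Int_assoc)
qed

text \<open>Exponential Markov inequality. The hypothesis on \<open>X\<close> keeps the factor
  \<open>l\<close> on both sides, so positive \<open>l\<close> gives upper tails and negative
  \<open>l\<close> gives lower tails.\<close>

lemma random_subset_chernoff:
  assumes E: "finite E" and F: "F \<subseteq> E" and w: "\<And>e. e \<in> F \<Longrightarrow> 0 \<le> w e \<and> w e \<le> 1"
    and X: "\<And>G. G \<in> X \<Longrightarrow> G \<subseteq> E \<Longrightarrow> l * a \<le> l * real (card (G \<inter> F))"
  shows "measure_pmf.prob (random_subset E w) X \<le> exp ((exp l - 1) * (\<Sum>e\<in>F. w e) - l * a)"
proof -
  let ?M = "measure_pmf (random_subset E w)"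
  have "measure_pmf.prob (random_subset E w) X = (\<integral>G. indicator X G \<partial>?M)"
    by simp
  also have "\<dots> \<le> (\<integral>G. exp (l * real (card (G \<inter> F))) * exp (- (l * a)) \<partial>?M)"
  proof (intro integral_mono_AE integrable_mult_left random_subset_mgf_le(1) assms)
    show "integrable ?M (indicator X :: _ \<Rightarrow> real)"
      by (rule integrable_pmf_bounded[of _ 1]) (auto simp: indicator_def)
    have "indicator X G \<le> exp (l * real (card (G \<inter> F))) * exp (- (l * a))" if "G \<subseteq> E" for G
      using X[OF _ that] by (auto simp: indicator_def exp_add[symmetric])
    then show "AE G in ?M. indicator X G \<le> exp (l * real (card (G \<inter> F))) * exp (- (l * a))"
      unfolding AE_measure_pmf_iff using set_pmf_random_subset[OF E, of _ w] by blast
  qed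
  also have "\<dots> \<le> exp ((exp l - 1) * (\<Sum>e\<in>F. w e)) * exp (- (l * a))"
    unfolding Bochner_Integration.integral_mult_left_zero
    by (intro mult_right_mono random_subset_mgf_le(2) assms) auto
  also have "\<dots> = exp ((exp l - 1) * (\<Sum>e\<in>F. w e) - l * a)" by (simp add: exp_add[symmetric])
  finally show ?thesis .
qed

section \<open>Resampling a vertex\<close>

lemma finite_vpairs [simp]: "finite (vpairs N)"
  by (rule finite_subset[of _ "Pow {1..N}"]) (auto simp: vpairs_def)

text \<open>The pairs split into those avoiding \<open>v\<close>, which keep their law, and those at
  \<open>v\<close>, which get a fresh independent draw. Gluing two independent parts gives
  independent edges again.\<close>

lemma indep_edges_resample:
  "bind_pmf (indep_edges (vpairs N) w) (resample_vertex N q v) =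
   indep_edges (vpairs N) (\<lambda>e. if v \<in> e then q else w e)"
proof -
  let ?E = "{e \<in> vpairs N. v \<notin> e}" and ?F = "{e \<in> vpairs N. v \<in> e}"
  let ?w = "\<lambda>e. if v \<in> e then q else w e"
  have "bind_pmf (indep_edges (vpairs N) w) (resample_vertex N q v) =
    bind_pmf (map_pmf (\<lambda>G. G \<inter> ?E) (random_subset (vpairs N) w))
      (\<lambda>G. map_pmf (\<lambda>H. G \<union> H) (random_subset ?F (\<lambda>_. q)))"
    unfolding bind_map_pmf indep_edges_def resample_vertex_def
  proof (intro bind_pmf_cong refl map_pmf_cong)
    fix f G
    assume "f \<in> set_pmf (Pi_pmf (vpairs N) False (\<lambda>e. bernoulli_pmf (w e)))"
    then have "Collect f \<subseteq> vpairs N"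
      by (rule set_Pi_pmf_False_subset[OF finite_vpairs])
    then show "{e \<in> Collect f. v \<notin> e} \<union> G = Collect f \<inter> ?E \<union> G" by blast
  qed
  also have "\<dots> = bind_pmf (random_subset ?E ?w)
      (\<lambda>G. map_pmf (\<lambda>H. G \<union> H) (random_subset ?F ?w))"
  proof -
    have "map_pmf (\<lambda>G. G \<inter> ?E) (random_subset (vpairs N) w) = random_subset ?E w"
      by (rule random_subset_Int) auto
    also have "\<dots> = random_subset ?E ?w"
      by (rule random_subset_cong) auto
    finally have E: "map_pmf (\<lambda>G. G \<inter> ?E) (random_subset (vpairs N) w) = random_subset ?E ?w" .
    have F: "random_subset ?F (\<lambda>_. q) = random_subset ?F ?w"
      by (rule random_subset_cong) auto
    show ?thesis unfolding E F ..
  qed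
  also have "\<dots> = random_subset (?E \<union> ?F) ?w"
    by (rule random_subset_Un[symmetric]) auto
  also have "?E \<union> ?F = vpairs N" by blast
  finally show ?thesis by (simp add: indep_edges_def)
qed

text \<open>No edge at \<open>v\<close> lies inside \<open>S - {v}\<close>, so giving these edges
  weight \<open>q\<close> amounts to removing \<open>v\<close> from the planted set.\<close>

lemma planted_graph_resample:
  "bind_pmf (planted_graph N S p q) (resample_vertex N q v) = planted_graph N (S - {v}) p q"
  unfolding planted_graph_def indep_edges_resample
  unfolding indep_edges_def by (rule random_subset_cong) auto

lemma planted_graph_empty: "planted_graph N {} p q = erdos_renyi N q"
  unfolding planted_graph_def erdos_renyi_def indep_edges_def
  by (rule random_subset_cong) (auto simp: vpairs_def)

section \<open>The scanning test\<close>

text \<open>Recovery precedes the resampling of \<open>v\<close>, so the observed graph itself is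
  tested and the fully resampled one is not. A round makes at most one call, one count and one
  resampling, which matches the claimed running time.\<close>

primrec scan_prog :: "nat \<Rightarrow> nat list \<Rightarrow> test_prog" where
  "scan_prog m [] = Answer False"
| "scan_prog m (v # vs) = Recover (IfEdges m (Answer True) (Resample v (scan_prog m vs)))"

text \<open>The law of the answer of \<open>scan_prog\<close>, without the running time.\<close>

primrec scan :: "nat \<Rightarrow> real \<Rightarrow> (graph, nat set) timed_alg \<Rightarrow> nat \<Rightarrow> nat list \<Rightarrow> graph \<Rightarrow> bool pmf" where
  "scan N q A m [] G = return_pmf False"
| "scan N q A m (v # vs) G = bind_pmf (A G) (\<lambda>(S, t).
     if m \<le> edges_inside S G then return_pmf True
     else bind_pmf (resample_vertex N q v G) (scan N q A m vs))"

lemma map_fst_spend [simp]: "map_pmf fst (spend s M) = map_pmf fst M"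
  by (simp add: spend_def pmf.map_comp o_def split_beta)

text \<open>The initial vertex set \<open>S\<close> may be arbitrary, because \<open>Recover\<close>
  overwrites it before any edges are counted.\<close>

lemma map_fst_exec_scan_prog:
  "map_pmf fst (exec_prog N q A (scan_prog m vs) S G) = scan N q A m vs G"
proof (induction vs arbitrary: S G)
  case (Cons v vs)
  then show ?case
    by (auto simp: map_bind_pmf split_beta intro!: bind_pmf_cong)
qed simp

lemma resample_vertex_subset:
  assumes "G \<subseteq> vpairs N" "H \<in> set_pmf (resample_vertex N q v G)"
  shows "H \<subseteq> vpairs N"
proof -
  obtain H' where "H' \<in> set_pmf (random_subset {e \<in> vpairs N. v \<in> e} (\<lambda>_. q))"
    "H = {e \<in> G. v \<notin> e} \<union> H'"
    using assms(2) by (auto simp: resample_vertex_def indep_edges_def)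
  then show ?thesis
    using assms(1) set_pmf_random_subset[of "{e \<in> vpairs N. v \<in> e}" H' "\<lambda>_. q"] by auto
qed

lemma recovery_algD:
  assumes "recovery_alg N K A" "G \<subseteq> vpairs N" "(S, t) \<in> set_pmf (A G)"
  shows "S \<subseteq> {1..N}" "card S = K"
  using assms unfolding recovery_alg_def by blast+

text \<open>A round costs at most \<open>N + T + K\<^sup>2\<close>, the last term because the output
  of \<open>A\<close> has exactly \<open>K\<close> vertices. Early rejection only shortens the
  run.\<close>

lemma exec_scan_prog_time_le:
  assumes "recovery_alg N K A" "runs_within N A T"
    and "G \<subseteq> vpairs N" "(b, t) \<in> set_pmf (exec_prog N q A (scan_prog m vs) S G)"
  shows "t \<le> length vs * (N + T + K\<^sup>2)"
  using assms(3,4)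
proof (induction vs arbitrary: S G b t)
  case (Cons v vs)
  let ?R = "\<lambda>S G. if m \<le> edges_inside S G then exec_prog N q A (Answer True) S G
    else exec_prog N q A (Resample v (scan_prog m vs)) S G"
  have exec: "exec_prog N q A (scan_prog m (v # vs)) S G =
      bind_pmf (A G) (\<lambda>(S', s). map_pmf (\<lambda>(x, u). (x, s + ((card S')\<^sup>2 + u))) (?R S' G))"
    by (simp add: spend_def pmf.map_comp o_def case_prod_unfold)
  obtain S' s u where A: "(S', s) \<in> set_pmf (A G)" and u: "(b, u) \<in> set_pmf (?R S' G)"
    and t: "t = s + ((card S')\<^sup>2 + u)"
    using Cons.prems(2) unfolding exec set_bind_pmf by (force simp del: exec_prog.simps)
  have s: "s \<le> T" and S': "card S' = K"
    using A Cons.prems(1) assms(1,2) by (auto simp: recovery_alg_def runs_within_def)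
  have "u \<le> N + length vs * (N + T + K\<^sup>2)"
  proof (cases "m \<le> edges_inside S' G")
    case True
    then show ?thesis using u by simp
  next
    case False
    then obtain H r where "H \<in> set_pmf (resample_vertex N q v G)"
      "(b, r) \<in> set_pmf (exec_prog N q A (scan_prog m vs) S' H)" "u = N + r"
      using u by (auto simp: spend_def)
    then show ?thesis
      using Cons.IH[of H b r S'] resample_vertex_subset Cons.prems(1) by auto
  qed
  then show ?case using s S' t by (simp add: algebra_simps)
qed simp

section \<open>Bounds for a single round of the scan\<close>

lemma scan_Cons_True_le:
  assumes "recovery_alg N K A" "G \<subseteq> vpairs N"
  shows "pmf (scan N q A m (v # vs) G) True \<le>
    indicator {G. \<exists>S. S \<subseteq> {1..N} \<and> card S = K \<and> m \<le> edges_inside S G} G +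
    pmf (bind_pmf (resample_vertex N q v G) (scan N q A m vs)) True"
proof (cases "\<exists>S. S \<subseteq> {1..N} \<and> card S = K \<and> m \<le> edges_inside S G")
  case True
  then show ?thesis by (simp add: pmf_le_1 add_increasing2 del: scan.simps)
next
  case False
  \<comment> \<open>Without a dense \<open>K\<close>-set in \<open>G\<close> this round cannot
    reject, whatever \<open>A\<close> returns. Nothing about the quality of \<open>A\<close> enters
    under the null law.\<close>
  have "scan N q A m (v # vs) G =
      bind_pmf (A G) (\<lambda>_. bind_pmf (resample_vertex N q v G) (scan N q A m vs))"
    unfolding scan.simps using False recovery_algD[OF assms]
    by (intro bind_pmf_cong refl) auto
  then show ?thesis by simp
qed

text \<open>Acceptance requires in particular that this round does not reject; later rounds are
  discarded. This serves the round in which \<open>K\<close> planted vertices remain.\<close>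

lemma scan_Cons_False_le_miss:
  "pmf (scan N q A m (v # vs) G) False \<le> measure_pmf.prob (A G) {(S, t). edges_inside S G < m}"
proof -
  have "pmf (scan N q A m (v # vs) G) False
      \<le> (\<integral>x. indicator {(S, t). edges_inside S G < m} x \<partial>measure_pmf (A G))"
    unfolding scan.simps pmf_bind
    by (intro integral_mono integrable_pmf_bounded[of _ 1])
      (auto simp: indicator_def pmf_le_1 abs_of_nonneg)
  then show ?thesis by simp
qed

text \<open>A round can only add rejections, so skipping it does not decrease the acceptance
  probability. This serves the rounds before the planted set has shrunk to size
  \<open>K\<close>.\<close>

lemma scan_Cons_False_le_rest:
  "pmf (scan N q A m (v # vs) G) False \<le>
    pmf (bind_pmf (resample_vertex N q v G) (scan N q A m vs)) False"
proof -
  have "pmf (scan N q A m (v # vs) G) False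
      \<le> (\<integral>x. pmf (bind_pmf (resample_vertex N q v G) (scan N q A m vs)) False \<partial>measure_pmf (A G))"
    unfolding scan.simps pmf_bind[of "A G"]
    by (intro integral_mono integrable_pmf_bounded[of _ 1])
      (auto simp: pmf_le_1 abs_of_nonneg)
  then show ?thesis by simp
qed

lemma set_pmf_planted_graph: "G \<in> set_pmf (planted_graph N S p q) \<Longrightarrow> G \<subseteq> vpairs N"
  unfolding planted_graph_def indep_edges_def by (rule set_pmf_random_subset) auto

text \<open>A union bound over the rounds: the null law is stationary under resampling, so every
  round sees an Erdos-Renyi graph.\<close>

lemma scan_erdos_renyi_True_le:
  assumes "recovery_alg N K A"
  shows "pmf (bind_pmf (erdos_renyi N q) (scan N q A m vs)) True \<le> real (length vs) *
    measure_pmf.prob (erdos_renyi N q) {G. \<exists>S. S \<subseteq> {1..N} \<and> card S = K \<and> m \<le> edges_inside S G}"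
    (is "_ \<le> _ * measure_pmf.prob _ ?D")
proof (induction vs)
  case (Cons v vs)
  let ?R = "\<lambda>G. bind_pmf (resample_vertex N q v G) (scan N q A m vs)"
  have stationary: "bind_pmf (erdos_renyi N q) (resample_vertex N q v) = erdos_renyi N q"
    using planted_graph_resample[of N "{}" q q v] by (simp add: planted_graph_empty)
  have "pmf (bind_pmf (erdos_renyi N q) (scan N q A m (v # vs))) True
      \<le> (\<integral>G. indicator ?D G + pmf (?R G) True \<partial>erdos_renyi N q)"
    unfolding pmf_bind[of "erdos_renyi N q"]
  proof (intro integral_mono_AE Bochner_Integration.integrable_add integrable_pmf_bounded[of _ 1])
    show "AE G in erdos_renyi N q. pmf (scan N q A m (v # vs) G) True \<le> indicator ?D G + pmf (?R G) True"
      using set_pmf_planted_graph[of _ N "{}" q q] unfolding AE_measure_pmf_iff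
      by (intro ballI scan_Cons_True_le assms) (simp add: planted_graph_empty)
  qed (auto simp: indicator_def pmf_le_1 abs_of_nonneg)
  also have "\<dots> = measure_pmf.prob (erdos_renyi N q) ?D + (\<integral>G. pmf (?R G) True \<partial>erdos_renyi N q)"
    by (subst Bochner_Integration.integral_add)
      (auto intro!: integrable_pmf_bounded[of _ 1] simp: indicator_def pmf_le_1 abs_of_nonneg)
  also have "(\<integral>G. pmf (?R G) True \<partial>erdos_renyi N q) =
      pmf (bind_pmf (erdos_renyi N q) (scan N q A m vs)) True"
    unfolding pmf_bind[symmetric] by (subst bind_assoc_pmf[symmetric], subst stationary) simp
  finally show ?case using Cons by (simp add: algebra_simps)
qed simp

section \<open>The planted set under successive deletions\<close>

text \<open>The planted set \<open>S\<close> at the first time that \<open>K\<close> of its vertices are not yet resampled.\<close>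

primrec shrink :: "nat \<Rightarrow> 'a set \<Rightarrow> 'a list \<Rightarrow> 'a set" where
  "shrink K S [] = S"
| "shrink K S (v # vs) = (if card S = K then S else shrink K (S - {v}) vs)"

lemma shrink_subset: "shrink K S vs \<subseteq> S"
proof (induction vs arbitrary: S)
  case (Cons v vs)
  then show ?case using Cons[of "S - {v}"] by auto
qed simp

text \<open>Each deletion lowers the size by at most one and the list exhausts \<open>S\<close>, so
  the size cannot jump over \<open>K\<close>.\<close>

lemma card_shrink:
  assumes "S \<subseteq> set vs" "K \<le> card S"
  shows "card (shrink K S vs) = K"
  using assms
proof (induction vs arbitrary: S)
  case (Cons v vs)
  show ?case
  proof (cases "card S = K")
    case False
    then have "K \<le> card (S - {v})"
      using Cons.prems by (auto simp: card_Diff_singleton_if)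
    then show ?thesis using Cons.IH[of "S - {v}"] Cons.prems False by auto
  qed simp
qed simp

text \<open>Shrinking sees vertex names only through equality. This equivariance is what makes the
  surviving set uniform.\<close>

lemma shrink_image:
  assumes "inj f"
  shows "shrink K (f ` S) (map f vs) = f ` shrink K S vs"
proof (induction vs arbitrary: S)
  case (Cons v vs)
  have "f ` S - {f v} = f ` (S - {v})"
    using assms by (auto simp: inj_def)
  then show ?case
    using Cons[of "S - {v}"] card_image[OF inj_on_subset[OF assms subset_UNIV], of S] by simp
qed simp

lemma scan_planted_False_le:
  assumes "0 < K" "S \<subseteq> set vs" "K \<le> card S"
  shows "pmf (bind_pmf (planted_graph N S p q) (scan N q A m vs)) False \<le>
    (\<integral>G. measure_pmf.prob (A G) {(S', t). edges_inside S' G < m} \<partial>planted_graph N (shrink K S vs) p q)"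
  using assms(2,3)
proof (induction vs arbitrary: S)
  case Nil
  \<comment> \<open>An empty list forces \<open>S\<close> to be empty, which contradicts
    \<open>0 < K \<le> card S\<close>.\<close>
  then show ?case using assms(1) by simp
next
  case (Cons v vs)
  show ?case
  proof (cases "card S = K")
    case True
    have "pmf (bind_pmf (planted_graph N S p q) (scan N q A m (v # vs))) False \<le>
      (\<integral>G. measure_pmf.prob (A G) {(S', t). edges_inside S' G < m} \<partial>planted_graph N S p q)"
      unfolding pmf_bind[of "planted_graph N S p q"]
      by (intro integral_mono integrable_pmf_bounded[of _ 1] scan_Cons_False_le_miss)
        (auto simp: pmf_le_1 abs_of_nonneg simp del: scan.simps)
    then show ?thesis using True by (simp del: scan.simps)
  next
    case False
    have "pmf (bind_pmf (planted_graph N S p q) (scan N q A m (v # vs))) False \<le>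
      (\<integral>G. pmf (bind_pmf (resample_vertex N q v G) (scan N q A m vs)) False \<partial>planted_graph N S p q)"
      unfolding pmf_bind[of "planted_graph N S p q"]
      by (intro integral_mono integrable_pmf_bounded[of _ 1] scan_Cons_False_le_rest)
        (auto simp: pmf_le_1 abs_of_nonneg simp del: scan.simps)
    also have "\<dots> = pmf (bind_pmf (planted_graph N (S - {v}) p q) (scan N q A m vs)) False"
      unfolding pmf_bind[symmetric] planted_graph_resample[symmetric]
      by (subst bind_assoc_pmf) simp
    also have "\<dots> \<le> (\<integral>G. measure_pmf.prob (A G) {(S', t). edges_inside S' G < m}
        \<partial>planted_graph N (shrink K (S - {v}) vs) p q)"
      using Cons.prems False by (intro Cons.IH) (auto simp: card_Diff_singleton_if)
    finally show ?thesis using False by (simp del: scan.simps)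
  qed
qed

text \<open>The output of \<open>A\<close> depends on the graph, so its edge count is not that of a
  fixed set. The miss is therefore charged either to a bad output or to the existence of some sparse
  good \<open>K\<close>-set, an event of the graph alone that a union bound can handle.\<close>

lemma miss_prob_le:
  assumes "recovery_alg N K A"
  shows "(\<integral>G. measure_pmf.prob (A G) {(S, t). edges_inside S G < m} \<partial>planted_graph N U p q) \<le>
    (\<integral>G. measure_pmf.prob (A G) {(S, t). \<not> good S} \<partial>planted_graph N U p q) +
    measure_pmf.prob (planted_graph N U p q)
      {G. \<exists>S. S \<subseteq> {1..N} \<and> card S = K \<and> good S \<and> edges_inside S G < m}"
    (is "_ \<le> _ + measure_pmf.prob _ ?D")
proof -
  have le: "measure_pmf.prob (A G) {(S, t). edges_inside S G < m} \<le>
      measure_pmf.prob (A G) {(S, t). \<not> good S} + indicator ?D G" if G: "G \<subseteq> vpairs N" for G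
  proof (cases "G \<in> ?D")
    case True
    then show ?thesis by (simp add: add_increasing)
  next
    case False
    then have "set_pmf (A G) \<inter> {(S, t). edges_inside S G < m} \<subseteq> {(S, t). \<not> good S}"
      using recovery_algD[OF assms G] by auto
    then have "measure_pmf.prob (A G) (set_pmf (A G) \<inter> {(S, t). edges_inside S G < m}) \<le>
        measure_pmf.prob (A G) {(S, t). \<not> good S}"
      by (intro measure_pmf.finite_measure_mono) auto
    then show ?thesis
      using False measure_Int_set_pmf[of "A G" "{(S, t). edges_inside S G < m}"]
      by (simp add: Int_commute)
  qed
  have "(\<integral>G. measure_pmf.prob (A G) {(S, t). edges_inside S G < m} \<partial>planted_graph N U p q) \<le>
    (\<integral>G. measure_pmf.prob (A G) {(S, t). \<not> good S} + indicator ?D G \<partial>planted_graph N U p q)"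
  proof (intro integral_mono_AE Bochner_Integration.integrable_add integrable_pmf_bounded[of _ 1])
    show "AE G in planted_graph N U p q. measure_pmf.prob (A G) {(S, t). edges_inside S G < m} \<le>
      measure_pmf.prob (A G) {(S, t). \<not> good S} + indicator ?D G"
      unfolding AE_measure_pmf_iff by (intro ballI le set_pmf_planted_graph)
  qed (auto simp: indicator_def abs_of_nonneg)
  also have "\<dots> = (\<integral>G. measure_pmf.prob (A G) {(S, t). \<not> good S} \<partial>planted_graph N U p q) +
    measure_pmf.prob (planted_graph N U p q) ?D"
    by (subst Bochner_Integration.integral_add)
      (auto intro!: integrable_pmf_bounded[of _ 1] simp: indicator_def abs_of_nonneg)
  finally show ?thesis .
qed

section \<open>Uniformity of the surviving set\<close>

lemma random_subset_permutes:
  assumes "finite V" "\<sigma> permutes V"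
  shows "map_pmf (image \<sigma>) (random_subset V (\<lambda>_. r)) = random_subset V (\<lambda>_. r)"
proof -
  have inv: "inv \<sigma> permutes V" using assms(2) by (rule permutes_inv)
  have "Pi_pmf V False (\<lambda>_. bernoulli_pmf r) =
      map_pmf (\<lambda>g. g \<circ> inv \<sigma>) (Pi_pmf V False (\<lambda>_. bernoulli_pmf r))"
    using permutes_imp_bij[OF inv] permutes_in_image[OF inv]
    by (intro Pi_pmf_bij_betw assms(1)) auto
  then have "random_subset V (\<lambda>_. r) = map_pmf Collect
      (map_pmf (\<lambda>g. g \<circ> inv \<sigma>) (Pi_pmf V False (\<lambda>_. bernoulli_pmf r)))"
    by (rule arg_cong)
  also have "\<dots> = map_pmf (image \<sigma>) (random_subset V (\<lambda>_. r))"
    unfolding pmf.map_comp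
    by (intro map_pmf_cong refl) (simp add: o_def bij_image_Collect_eq[OF permutes_bij[OF assms(2)]])
  finally show ?thesis ..
qed

text \<open>Transitivity of the symmetric group on sets of equal size: a bijection between the sets
  is glued to one between their complements.\<close>

lemma ex_permutes_image_eq:
  assumes "finite V" "U \<subseteq> V" "U' \<subseteq> V" "card U = card U'"
  shows "\<exists>\<sigma>. \<sigma> permutes V \<and> \<sigma> ` U = U'"
proof -
  have fin: "finite U" "finite U'" using assms finite_subset by auto
  obtain f where f: "bij_betw f U U'"
    using finite_same_card_bij[OF fin assms(4)] by blast
  have "card (V - U) = card (V - U')"
    using assms fin by (simp add: card_Diff_subset)
  then obtain g where g: "bij_betw g (V - U) (V - U')"
    using finite_same_card_bij[of "V - U" "V - U'"] assms(1) by blast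
  define \<sigma> where "\<sigma> x = (if x \<in> U then f x else if x \<in> V then g x else x)" for x
  have \<sigma>f: "bij_betw \<sigma> U U'" 
    using f by (rule bij_betw_cong[THEN iffD1, rotated]) (simp add: \<sigma>_def)
  have \<sigma>g: "bij_betw \<sigma> (V - U) (V - U')"
    using g by (rule bij_betw_cong[THEN iffD1, rotated]) (simp add: \<sigma>_def)
  have "bij_betw \<sigma> (U \<union> (V - U)) (U' \<union> (V - U'))"
    by (rule bij_betw_combine[OF \<sigma>f \<sigma>g]) auto
  then have "bij_betw \<sigma> V V" using assms(2,3) by (simp add: Un_absorb1)
  then have "\<sigma> permutes V"
    by (rule bij_imp_permutes) (use assms(2) in \<open>auto simp: \<sigma>_def\<close>)
  then show ?thesis using \<sigma>f by (auto simp: bij_betw_def)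
qed

text \<open>A binomial random set and a random deletion order are jointly invariant under relabelling,
  so the surviving set of size \<open>K\<close> is uniformly distributed.\<close>

lemma prob_shrink_le:
  assumes V: "finite V" and U: "U \<subseteq> V" "card U = K"
  shows "measure_pmf.prob (pair_pmf (random_subset V (\<lambda>_. r)) (pmf_of_set (permutations_of_set V)))
      {(S, vs). K \<le> card S \<and> shrink K S vs = U} \<le> 1 / real (card {U. U \<subseteq> V \<and> card U = K})"
    (is "measure_pmf.prob ?J (?D U) \<le> 1 / real (card ?Z)")
proof -
  have inv: "measure_pmf.prob ?J (?D U') = measure_pmf.prob ?J (?D U)" if U': "U' \<in> ?Z" for U'
  proof -
    obtain \<sigma> where \<sigma>: "\<sigma> permutes V" "\<sigma> ` U = U'"
      using ex_permutes_image_eq[OF V U(1), of U'] U' U(2) by auto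
    have inj: "inj \<sigma>" using \<sigma>(1) by (rule permutes_inj)
    have perms: "map_pmf (map \<sigma>) (pmf_of_set (permutations_of_set V)) = pmf_of_set (permutations_of_set V)"
      using V inj by (subst map_pmf_of_set_inj)
        (auto simp: permutations_of_set_image_permutes[OF \<sigma>(1)] inj_on_def)
    have "map_pmf (\<lambda>(S, vs). (\<sigma> ` S, map \<sigma> vs)) ?J = ?J"
      unfolding map_pair random_subset_permutes[OF V \<sigma>(1)] perms ..
    then have "measure_pmf.prob ?J (?D U') =
        measure_pmf.prob (map_pmf (\<lambda>(S, vs). (\<sigma> ` S, map \<sigma> vs)) ?J) (?D U')"
      by (rule arg_cong[OF sym])
    also have "\<dots> = measure_pmf.prob ?J ((\<lambda>(S, vs). (\<sigma> ` S, map \<sigma> vs)) -` ?D U')"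
      by (rule measure_map_pmf)
    also have "(\<lambda>(S, vs). (\<sigma> ` S, map \<sigma> vs)) -` ?D U' = ?D U"
      using card_image[OF inj_on_subset[OF inj subset_UNIV]] inj
      by (auto simp: shrink_image[OF inj] \<sigma>(2)[symmetric] inj_image_eq_iff)
    finally show ?thesis .
  qed
  have finZ: "finite ?Z" using V by simp
  have "U \<in> ?Z" using U by simp
  then have pos: "card ?Z > 0" using finZ card_gt_0_iff by blast
  \<comment> \<open>All \<open>K\<close>-sets are equally likely to survive and the events are
    disjoint. Only an inequality results, since \<open>S\<close> may have fewer than
    \<open>K\<close> vertices.\<close>
  have "real (card ?Z) * measure_pmf.prob ?J (?D U) = (\<Sum>U'\<in>?Z. measure_pmf.prob ?J (?D U'))"
    using inv by simp
  also have "\<dots> = measure_pmf.prob ?J (\<Union>U'\<in>?Z. ?D U')"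
    by (rule measure_pmf.finite_measure_finite_Union[symmetric, OF finZ])
      (auto simp: disjoint_family_on_def)
  also have "\<dots> \<le> 1" by simp
  finally show ?thesis using pos by (simp add: field_simps)
qed

lemma set_pmf_of_permutations:
  "finite V \<Longrightarrow> set_pmf (pmf_of_set (permutations_of_set V)) = permutations_of_set V"
  by (rule set_pmf_of_set) auto

text \<open>Passes from the surviving set to a uniform \<open>K\<close>-set. Nonnegativity of
  \<open>f\<close> lets the pointwise bound \<open>prob_shrink_le\<close> be summed.\<close>

lemma expectation_shrink_le:
  fixes f :: "'a set \<Rightarrow> real"
  assumes V: "finite V" and f: "\<And>U. 0 \<le> f U"
  shows "(\<integral>x. (case x of (S, vs) \<Rightarrow> if K \<le> card S then f (shrink K S vs) else 0)
      \<partial>pair_pmf (random_subset V (\<lambda>_. r)) (pmf_of_set (permutations_of_set V)))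
    \<le> (\<Sum>U | U \<subseteq> V \<and> card U = K. f U) / real (card {U. U \<subseteq> V \<and> card U = K})"
    (is "(\<integral>x. ?h x \<partial>measure_pmf ?J) \<le> _ / real (card ?Z)")
proof -
  let ?D = "\<lambda>U. {(S, vs). K \<le> card S \<and> shrink K S vs = U}"
  have finZ: "finite ?Z" using V by simp
  \<comment> \<open>On the support, if \<open>K \<le> card S\<close> then exactly one
    \<open>K\<close>-set is the surviving one; otherwise both sides vanish.\<close>
  have AE: "?h x = (\<Sum>U\<in>?Z. f U * indicator (?D U) x)" if x_in: "x \<in> set_pmf ?J" for x
  proof -
    obtain S vs where x: "x = (S, vs)" by (cases x)
    have S: "S \<subseteq> V" and vs: "set vs = V"
      using x_in set_pmf_random_subset[OF V, of S "\<lambda>_. r"] permutations_of_setD(1)[of vs V]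
      unfolding x set_pair_pmf set_pmf_of_permutations[OF V] by auto
    show ?thesis
    proof (cases "K \<le> card S")
      case True
      have "shrink K S vs \<in> ?Z"
        using S vs card_shrink[of S vs K] shrink_subset[of K S vs] True by auto
      then have "f (shrink K S vs) = (\<Sum>U\<in>?Z. if U = shrink K S vs then f U else 0)"
        using finZ by simp
      also have "\<dots> = (\<Sum>U\<in>?Z. f U * indicator (?D U) x)"
        using True by (intro sum.cong) (auto simp: x indicator_def)
      finally show ?thesis using True by (simp add: x)
    qed (simp add: x)
  qed
  have "(\<integral>x. ?h x \<partial>?J) = (\<integral>x. (\<Sum>U\<in>?Z. f U * indicator (?D U) x) \<partial>?J)"
    by (rule integral_cong_AE) (use AE in \<open>auto simp: AE_measure_pmf_iff\<close>)
  also have "\<dots> = (\<Sum>U\<in>?Z. f U * measure_pmf.prob ?J (?D U))"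
  proof -
    have "integrable ?J (\<lambda>x. indicator (?D U) x :: real)" for U
      by (rule integrable_pmf_bounded[of _ 1]) (auto simp: indicator_def)
    then show ?thesis
      by (subst Bochner_Integration.integral_sum) auto
  qed
  also have "\<dots> \<le> (\<Sum>U\<in>?Z. f U * (1 / real (card ?Z)))"
    by (intro sum_mono mult_left_mono f prob_shrink_le V) auto
  also have "\<dots> = (\<Sum>U\<in>?Z. f U) / real (card ?Z)"
    by (simp add: sum_divide_distrib)
  finally show ?thesis .
qed

text \<open>Puts the failure probability into the shape of the right-hand side of
  \<open>expectation_shrink_le\<close>, an average over \<open>K\<close>-subsets.\<close>

lemma pdsr_failure_prob:
  assumes "K \<le> N"
  shows "1 - pdsr_success_prob N K p q \<epsilon> A =
    (\<Sum>U | U \<subseteq> {1..N} \<and> card U = K.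
      (\<integral>G. measure_pmf.prob (A G) {(S, t). \<not> (1 - \<epsilon>) * real K \<le> real (card (S \<inter> U))}
        \<partial>planted_graph N U p q)) / real (card {U. U \<subseteq> {1..N} \<and> card U = K})"
proof -
  let ?Z = "{U. U \<subseteq> {1..N} \<and> card U = K}"
  let ?L = "bind_pmf (pds_fixed_size N K p q) (\<lambda>(S, G). map_pmf (\<lambda>(S', t). (S, S')) (A G))"
  let ?X = "{(S, S'). real (card (S' \<inter> S)) \<ge> (1 - \<epsilon>) * real K}"
  have "?Z \<noteq> {}" using obtain_subset_with_card_n[of K "{1..N}"] assms by auto
  have L: "?L = bind_pmf (pmf_of_set ?Z) (\<lambda>U. bind_pmf (planted_graph N U p q)
      (\<lambda>G. map_pmf (\<lambda>(S', t). (U, S')) (A G)))"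
    unfolding pds_fixed_size_def bind_assoc_pmf bind_map_pmf by simp
  have eq: "measure_pmf.prob (map_pmf (\<lambda>(S', t). (U, S')) (A G)) (- ?X) =
      measure_pmf.prob (A G) {(S, t). \<not> (1 - \<epsilon>) * real K \<le> real (card (S \<inter> U))}" for U G
    unfolding measure_map_pmf by (rule arg_cong[where f = "measure_pmf.prob (A G)"]) auto
  have "1 - pdsr_success_prob N K p q \<epsilon> A = measure_pmf.prob ?L (- ?X)"
    unfolding pdsr_success_prob_def using measure_pmf.prob_compl[of ?X ?L] by (simp add: Compl_eq_Diff_UNIV)
  also have "\<dots> = (\<Sum>U\<in>?Z. (\<integral>G. measure_pmf.prob (map_pmf (\<lambda>(S', t). (U, S')) (A G)) (- ?X)
      \<partial>planted_graph N U p q)) / real (card ?Z)"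
    unfolding L measure_bind_pmf_eq_integral
    by (rule integral_pmf_of_set) (use \<open>?Z \<noteq> {}\<close> in auto)
  finally show ?thesis unfolding eq .
qed

section \<open>Edge counts inside vertex sets\<close>

lemma edges_inside_eq:
  "G \<subseteq> vpairs N \<Longrightarrow> edges_inside S G = card (G \<inter> {e \<in> vpairs N. e \<subseteq> S})"
  unfolding edges_inside_def by (rule arg_cong[where f = card]) auto

lemma card_vpairs_inside:
  assumes "S \<subseteq> {1..N}"
  shows "card {e \<in> vpairs N. e \<subseteq> S} = card S choose 2"
proof -
  have "{e \<in> vpairs N. e \<subseteq> S} = {e. e \<subseteq> S \<and> card e = 2}"
    using assms by (auto simp: vpairs_def)
  then show ?thesis using n_subsets[OF finite_subset[OF assms finite_atLeastAtMost]] by simp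
qed

text \<open>The expected edge count inside \<open>S\<close>: every pair contributes
  \<open>q\<close>, and the pairs inside \<open>S \<inter> U\<close> an additional
  \<open>p - q\<close>.\<close>

lemma sum_planted_weights:
  fixes p q :: real
  assumes "S \<subseteq> {1..N}"
  shows "(\<Sum>e | e \<in> vpairs N \<and> e \<subseteq> S. if e \<subseteq> U then p else q) =
    real (card S choose 2) * q + real (card (S \<inter> U) choose 2) * (p - q)"
proof -
  let ?F = "{e \<in> vpairs N. e \<subseteq> S}"
  have "(\<Sum>e\<in>?F. if e \<subseteq> U then p else q) = (\<Sum>e\<in>?F. q + (if e \<subseteq> U then p - q else 0))"
    by (intro sum.cong) auto
  also have "\<dots> = real (card ?F) * q + (\<Sum>e\<in>{e \<in> ?F. e \<subseteq> U}. p - q)"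
    unfolding sum.distrib by (subst sum.inter_filter) auto
  also have "{e \<in> ?F. e \<subseteq> U} = {e \<in> vpairs N. e \<subseteq> S \<inter> U}" by auto
  finally show ?thesis
    using card_vpairs_inside[OF assms] card_vpairs_inside[of "S \<inter> U" N] assms by auto
qed

lemma planted_edges_chernoff:
  assumes "0 \<le> p" "p \<le> 1" "0 \<le> q" "q \<le> 1" "S \<subseteq> {1..N}"
    and X: "\<And>G. G \<in> X \<Longrightarrow> l * a \<le> l * real (edges_inside S G)"
  shows "measure_pmf.prob (planted_graph N U p q) X \<le>
    exp ((exp l - 1) * (real (card S choose 2) * q + real (card (S \<inter> U) choose 2) * (p - q)) - l * a)"
  unfolding planted_graph_def indep_edges_def sum_planted_weights[OF assms(5), of U, symmetric]
  by (rule random_subset_chernoff) (use assms(1-4) X in \<open>auto simp: edges_inside_eq[symmetric]\<close>)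

lemma prob_Ex_le:
  assumes "finite Z" "\<And>z. z \<in> Z \<Longrightarrow> measure_pmf.prob M {x. P z x} \<le> B"
  shows "measure_pmf.prob M {x. \<exists>z\<in>Z. P z x} \<le> real (card Z) * B"
proof -
  have "{x. \<exists>z\<in>Z. P z x} = (\<Union>z\<in>Z. {x. P z x})" by auto
  then have "measure_pmf.prob M {x. \<exists>z\<in>Z. P z x} \<le> (\<Sum>z\<in>Z. measure_pmf.prob M {x. P z x})"
    using measure_pmf.finite_measure_subadditive_finite[OF assms(1)] by simp
  also have "\<dots> \<le> (\<Sum>z\<in>Z. B)" by (intro sum_mono assms(2))
  finally show ?thesis by simp
qed

lemma card_K_subsets_le:
  assumes "0 < N" "K \<le> N"
  shows "real (card {S. S \<subseteq> {1..N} \<and> card S = K}) \<le> exp (real K * ln (real N))"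
proof -
  have "real (N choose K) \<le> real (N ^ K)"
    using binomial_le_pow[OF assms(2)] of_nat_le_iff by blast
  also have "\<dots> = exp (real K * ln (real N))"
    using assms(1) by (simp add: exp_of_nat_mult)
  finally show ?thesis using n_subsets[of "{1..N}" K] by simp
qed

section \<open>Tail exponents for edge counts and community size\<close>

lemma exp_minus_le_quadratic:
  fixes l :: real
  assumes "0 \<le> l"
  shows "exp (- l) \<le> 1 - l + l\<^sup>2"
proof -
  have "exp (- l) = inverse (exp l)" by (simp add: exp_minus)
  also have "\<dots> \<le> inverse (1 + l)" using assms by (intro le_imp_inverse_le exp_ge_add_one_self) auto
  also have "\<dots> \<le> 1 - l + l\<^sup>2"
  proof -
    \<comment> \<open>The product equals \<open>1 + l * l * l\<close>.\<close>
    have "1 \<le> (1 - l + l\<^sup>2) * (1 + l)"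
      using assms by (simp add: algebra_simps power2_eq_square)
    then show ?thesis using assms by (simp add: field_simps)
  qed
  finally show ?thesis .
qed

text \<open>Here \<open>M\<close> stands for the number of pairs in a \<open>K\<close>-set and
  \<open>k\<close> for the square of \<open>K\<close>. The threshold lies
  \<open>\<gamma> * k * q\<close> above the null mean \<open>M * q\<close>. Since
  \<open>l \<le> \<gamma>\<close>, the quadratic error uses up at most half of the linear gain
  \<open>l * \<gamma> * k * q\<close>.\<close>

lemma upper_tail_exponent:
  fixes \<gamma> M k q :: real
  assumes "0 < \<gamma>" "0 < q" "0 \<le> M" "M \<le> k / 2"
  defines "l \<equiv> \<gamma> / (1 + 4 * \<gamma>)"
  shows "(exp l - 1) * (M * q) - l * (M * q + \<gamma> * k * q) \<le> - (l * \<gamma> / 2) * k * q"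
proof -
  have l: "0 < l" "l \<le> 1" "l \<le> \<gamma>" using assms(1) by (auto simp: l_def field_simps)
  have "(exp l - 1) * (M * q) \<le> (l + l\<^sup>2) * (M * q)"
    using exp_bound[of l] l assms by (intro mult_right_mono) auto
  moreover have "l\<^sup>2 * (M * q) \<le> l * \<gamma> * (k / 2 * q)"
    unfolding power2_eq_square using l assms by (intro mult_mono) auto
  ultimately show ?thesis by (simp add: algebra_simps)
qed

text \<open>The planted mean \<open>\<mu>\<close> exceeds the same threshold by at least
  \<open>\<gamma> * k * q\<close>. The choice of \<open>l\<close> gives
  \<open>l * (1 / 2 + 2 * \<gamma>) = \<gamma> / 2\<close>, so again half of the gain survives, with
  the same rate as for the upper tail.\<close>

lemma lower_tail_exponent:
  fixes \<gamma> M k q \<mu> :: real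
  assumes "0 < \<gamma>" "0 < q" "0 \<le> M" "M \<le> k / 2" "M * q + 2 * \<gamma> * k * q \<le> \<mu>"
  defines "l \<equiv> \<gamma> / (1 + 4 * \<gamma>)"
  shows "(exp (- l) - 1) * \<mu> + l * (M * q + \<gamma> * k * q) \<le> - (l * \<gamma> / 2) * k * q"
proof -
  have l: "0 < l" "l \<le> 1" and l_eq: "l * (1 / 2 + 2 * \<gamma>) = \<gamma> / 2"
    using assms(1) by (auto simp: l_def field_simps)
  have "(exp (- l) - 1) * \<mu> \<le> (exp (- l) - 1) * (M * q + 2 * \<gamma> * k * q)"
    using l assms(5) by (intro mult_left_mono_neg) auto
  also have "\<dots> \<le> (- l + l\<^sup>2) * (M * q + 2 * \<gamma> * k * q)"
    using exp_minus_le_quadratic[of l] l assms by (intro mult_right_mono) auto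
  finally have "(exp (- l) - 1) * \<mu> + l * (M * q + \<gamma> * k * q) \<le>
      l\<^sup>2 * (M + 2 * \<gamma> * k) * q - l * \<gamma> * k * q"
    by (simp add: algebra_simps)
  also have "l\<^sup>2 * (M + 2 * \<gamma> * k) * q \<le> l\<^sup>2 * ((1 / 2 + 2 * \<gamma>) * k) * q"
    using assms by (intro mult_right_mono mult_left_mono) (auto simp: algebra_simps)
  also have "\<dots> = l * (l * (1 / 2 + 2 * \<gamma>)) * k * q" by (simp add: power2_eq_square)
  finally show ?thesis unfolding l_eq by (simp add: algebra_simps)
qed

lemma real_choose_two: "real (n choose 2) = real n * (real n - 1) / 2"
  by (induction n) (auto simp: numeral_2_eq_2 field_simps)

lemma random_subset_size_lower_tail:
  assumes "0 < N" "2 * K \<le> N"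
  shows "measure_pmf.prob (random_subset {1..N} (\<lambda>_. real (2 * K) / real N)) {S. card S < K}
    \<le> exp (- (1 / 8) * real K)"
proof -
  have "measure_pmf.prob (random_subset {1..N} (\<lambda>_. real (2 * K) / real N)) {S. card S < K}
      \<le> exp ((exp (- (1 / 4)) - 1) * (\<Sum>e\<in>{1..N}. real (2 * K) / real N) - - (1 / 4) * real K)"
  proof (rule random_subset_chernoff)
    show "0 \<le> real (2 * K) / real N \<and> real (2 * K) / real N \<le> 1"
      using assms by (auto simp del: of_nat_mult)
    show "- (1 / 4) * real K \<le> - (1 / 4) * real (card (S \<inter> {1..N}))"
      if "S \<in> {S. card S < K}" "S \<subseteq> {1..N}" for S
      using that by (simp add: Int_absorb2)
  qed auto
  also have "(\<Sum>e\<in>{1..N}. real (2 * K) / real N) = 2 * real K"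
    using assms(1) by simp
  also have "exp ((exp (- (1 / 4)) - 1) * (2 * real K) - - (1 / 4) * real K) \<le> exp (- (1 / 8) * real K)"
  proof -
    \<comment> \<open>The mean is \<open>2 * K\<close> and the tilt is \<open>-1/4\<close>; the
      quadratic bound gives \<open>exp (-1/4) \<le> 13/16\<close>, and
      \<open>-3/8 + 1/4 = -1/8\<close>.\<close>
    have "(exp (- (1 / 4 :: real)) - 1) * (2 * real K) \<le> (- (3 / 16)) * (2 * real K)"
      using exp_minus_le_quadratic[of "1 / 4"]
      by (intro mult_right_mono) (auto simp: power2_eq_square)
    then show ?thesis by simp
  qed
  finally show ?thesis .
qed

section \<open>Error of the scanning test\<close>

abbreviation scan_test :: "nat \<Rightarrow> nat \<Rightarrow> test_prog pmf" where
  "scan_test N m \<equiv> map_pmf (scan_prog m) (pmf_of_set (permutations_of_set {1..N}))"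

lemma runs_within_scan_test:
  assumes "recovery_alg N K A" "runs_within N A T"
  shows "runs_within N (run_test N q A (scan_test N m)) (N\<^sup>2 + N * T + N * K\<^sup>2)"
  unfolding runs_within_def
proof (intro allI impI ballI)
  fix G x
  assume G: "G \<subseteq> vpairs N" and x: "x \<in> set_pmf (run_test N q A (scan_test N m) G)"
  obtain b t where bt: "x = (b, t)" by (cases x)
  obtain vs where vs: "vs \<in> permutations_of_set {1..N}"
    and t: "(b, t) \<in> set_pmf (exec_prog N q A (scan_prog m vs) {} G)"
    using x unfolding bt run_test_def bind_map_pmf set_bind_pmf
      set_pmf_of_permutations[OF finite_atLeastAtMost] by blast
  have "t \<le> length vs * (N + T + K\<^sup>2)"
    by (rule exec_scan_prog_time_le[OF assms G t])
  also have "length vs = N" using length_finite_permutations_of_set[OF vs] by simp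
  finally show "case x of (b, t) \<Rightarrow> t \<le> N\<^sup>2 + N * T + N * K\<^sup>2"
    by (simp add: bt algebra_simps power2_eq_square)
qed

lemma pds_error_scan_test:
  "pds_error N K p q (run_test N q A (scan_test N m)) =
    pmf (bind_pmf (erdos_renyi N q)
      (\<lambda>G. bind_pmf (pmf_of_set (permutations_of_set {1..N})) (\<lambda>vs. scan N q A m vs G))) True +
    pmf (bind_pmf (pds_random_size N K p q)
      (\<lambda>G. bind_pmf (pmf_of_set (permutations_of_set {1..N})) (\<lambda>vs. scan N q A m vs G))) False"
proof -
  have True_eq: "measure_pmf.prob M {(b, t). b} = pmf (map_pmf fst M) True" for M :: "(bool \<times> nat) pmf"
  proof -
    have "{(b, t :: nat). b} = fst -` {True}" by (auto simp: vimage_def)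
    then show ?thesis by (simp only: pmf_map)
  qed
  have False_eq: "measure_pmf.prob M {(b, t). \<not> b} = pmf (map_pmf fst M) False" for M :: "(bool \<times> nat) pmf"
  proof -
    have "{(b, t :: nat). \<not> b} = fst -` {False}" by (auto simp: vimage_def)
    then show ?thesis by (simp only: pmf_map)
  qed
  have fst_run: "map_pmf fst (bind_pmf D (run_test N q A (scan_test N m))) =
      bind_pmf D (\<lambda>G. bind_pmf (pmf_of_set (permutations_of_set {1..N})) (\<lambda>vs. scan N q A m vs G))" for D
    unfolding run_test_def map_bind_pmf bind_map_pmf map_fst_exec_scan_prog ..
  show ?thesis
    unfolding pds_error_def True_eq False_eq fst_run ..
qed

lemma scan_test_type_I_le:
  assumes "recovery_alg N K A"
  shows "pmf (bind_pmf (erdos_renyi N q)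
      (\<lambda>G. bind_pmf (pmf_of_set (permutations_of_set {1..N})) (\<lambda>vs. scan N q A m vs G))) True \<le>
    real N * measure_pmf.prob (erdos_renyi N q)
      {G. \<exists>S. S \<subseteq> {1..N} \<and> card S = K \<and> m \<le> edges_inside S G}"
    (is "_ \<le> ?B")
proof -
  let ?P = "pmf_of_set (permutations_of_set {1..N})"
  have "pmf (bind_pmf (erdos_renyi N q) (\<lambda>G. bind_pmf ?P (\<lambda>vs. scan N q A m vs G))) True =
      (\<integral>vs. pmf (bind_pmf (erdos_renyi N q) (scan N q A m vs)) True \<partial>?P)"
    unfolding bind_commute_pmf[of "erdos_renyi N q" ?P] pmf_bind[of ?P] ..
  also have "\<dots> \<le> (\<integral>vs. ?B \<partial>?P)"
  proof (rule integral_mono_AE)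
    show "integrable ?P (\<lambda>vs. pmf (bind_pmf (erdos_renyi N q) (scan N q A m vs)) True)"
      by (rule integrable_pmf_bounded[of _ 1]) (simp add: pmf_le_1)
    show "AE vs in ?P. pmf (bind_pmf (erdos_renyi N q) (scan N q A m vs)) True \<le> ?B"
      unfolding AE_measure_pmf_iff set_pmf_of_permutations[OF finite_atLeastAtMost]
    proof
      fix vs assume "vs \<in> permutations_of_set {1..N}"
      then have "length vs = N" using length_finite_permutations_of_set[of vs "{1..N}"] by simp
      then show "pmf (bind_pmf (erdos_renyi N q) (scan N q A m vs)) True \<le> ?B"
        using scan_erdos_renyi_True_le[OF assms, of q m vs] by simp
    qed
  qed simp
  finally show ?thesis by simp
qed

text \<open>Acceptance is charged to three events: fewer than \<open>K\<close> planted vertices,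
  failure of \<open>A\<close> when the planted set is the surviving one, and a sparse
  \<open>K\<close>-set overlapping it well. Uniformity of the surviving set turns the second into
  the failure probability of the recovery problem.\<close>

lemma scan_test_type_II_le:
  assumes A: "recovery_alg N K A" and K: "0 < K" "2 * K \<le> N"
    and \<rho>: "0 \<le> \<rho>" "\<And>U. U \<subseteq> {1..N} \<Longrightarrow> card U = K \<Longrightarrow>
      measure_pmf.prob (planted_graph N U p q)
        {G. \<exists>S. S \<subseteq> {1..N} \<and> card S = K \<and> (1 - \<epsilon>) * real K \<le> real (card (S \<inter> U)) \<and>
          edges_inside S G < m} \<le> \<rho>"
  shows "pmf (bind_pmf (pds_random_size N (2 * K) p q)
      (\<lambda>G. bind_pmf (pmf_of_set (permutations_of_set {1..N})) (\<lambda>vs. scan N q A m vs G))) False \<le>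
    exp (- (1 / 8) * real K) + (1 - pdsr_success_prob N K p q \<epsilon> A) + \<rho>"
proof -
  let ?P = "pmf_of_set (permutations_of_set {1..N})"
  let ?S = "random_subset {1..N} (\<lambda>_. real (2 * K) / real N)"
  let ?J = "pair_pmf ?S ?P"
  define f where "f U = (\<integral>G. measure_pmf.prob (A G)
    {(S, t). \<not> (1 - \<epsilon>) * real K \<le> real (card (S \<inter> U))} \<partial>planted_graph N U p q)" for U
  have f: "0 \<le> f U" "f U \<le> 1" for U
    unfolding f_def by (auto intro!: measure_pmf.integral_le_const integrable_pmf_bounded[of _ 1] simp: abs_of_nonneg)
  let ?small = "\<lambda>x :: nat set \<times> nat list. indicator {S. card S < K} (fst x) :: real"
  let ?fail = "\<lambda>x. (case x of (S, vs) \<Rightarrow> if K \<le> card S then f (shrink K S vs) else 0)"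
  have int: "integrable ?J ?small" "integrable ?J ?fail"
    by (auto intro!: integrable_pmf_bounded[of _ 1] simp: f indicator_def abs_of_nonneg split: prod.split)
  have "pmf (bind_pmf (pds_random_size N (2 * K) p q) (\<lambda>G. bind_pmf ?P (\<lambda>vs. scan N q A m vs G))) False =
      (\<integral>x. pmf (bind_pmf (planted_graph N (fst x) p q) (scan N q A m (snd x))) False \<partial>?J)"
  proof -
    \<comment> \<open>The order is independent of the graph, so it can be drawn together with the
      community before the edges; this fixes the surviving set in advance.\<close>
    have "bind_pmf (pds_random_size N (2 * K) p q) (\<lambda>G. bind_pmf ?P (\<lambda>vs. scan N q A m vs G)) =
        bind_pmf ?S (\<lambda>S. bind_pmf (planted_graph N S p q) (\<lambda>G. bind_pmf ?P (\<lambda>vs. scan N q A m vs G)))"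
      unfolding pds_random_size_def bind_assoc_pmf ..
    also have "\<dots> = bind_pmf ?S (\<lambda>S. bind_pmf ?P (\<lambda>vs. bind_pmf (planted_graph N S p q) (scan N q A m vs)))"
      unfolding bind_commute_pmf[of _ ?P] ..
    also have "\<dots> = bind_pmf ?J (\<lambda>x. bind_pmf (planted_graph N (fst x) p q) (scan N q A m (snd x)))"
      unfolding pair_pmf_def bind_assoc_pmf bind_return_pmf by simp
    finally show ?thesis unfolding pmf_bind[of ?J, symmetric] by simp
  qed
  also have "\<dots> \<le> (\<integral>x. ?small x + ?fail x + \<rho> \<partial>?J)"
  proof (intro integral_mono_AE Bochner_Integration.integrable_add int)
    show "integrable ?J (\<lambda>x. pmf (bind_pmf (planted_graph N (fst x) p q) (scan N q A m (snd x))) False)"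
      by (rule integrable_pmf_bounded[of _ 1]) (auto simp: pmf_le_1 abs_of_nonneg)
    show "AE x in ?J. pmf (bind_pmf (planted_graph N (fst x) p q) (scan N q A m (snd x))) False
        \<le> ?small x + ?fail x + \<rho>"
      unfolding AE_measure_pmf_iff
    proof
      fix x assume x: "x \<in> set_pmf ?J"
      obtain S vs where xeq: "x = (S, vs)" by (cases x)
      have S: "S \<subseteq> {1..N}" and vs: "set vs = {1..N}"
        using x set_pmf_random_subset[of "{1..N}" S "\<lambda>_. real (2 * K) / real N"]
          permutations_of_setD(1)[of vs "{1..N}"]
        unfolding xeq set_pair_pmf set_pmf_of_permutations[OF finite_atLeastAtMost] by auto
      show "pmf (bind_pmf (planted_graph N (fst x) p q) (scan N q A m (snd x))) False
        \<le> ?small x + ?fail x + \<rho>"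
      proof (cases "K \<le> card S")
        case True
        let ?U = "shrink K S vs"
        have U: "?U \<subseteq> {1..N}" "card ?U = K"
          using S vs card_shrink[of S vs K] shrink_subset[of K S vs] True by auto
        have "pmf (bind_pmf (planted_graph N S p q) (scan N q A m vs)) False \<le>
          (\<integral>G. measure_pmf.prob (A G) {(S', t). edges_inside S' G < m} \<partial>planted_graph N ?U p q)"
          by (rule scan_planted_False_le) (use K S vs True in auto)
        also have "\<dots> \<le> f ?U + \<rho>"
          unfolding f_def
          by (rule order_trans[OF miss_prob_le[OF A]], rule add_left_mono, rule \<rho>(2)[OF U])
        finally show ?thesis using True by (simp add: xeq)
      next
        case False
        then show ?thesis
          using \<rho>(1) by (simp add: xeq pmf_le_1 add_increasing2)
      qed
    qed
  qed simp
  also have "\<dots> = (\<integral>x. ?small x \<partial>?J) + (\<integral>x. ?fail x \<partial>?J) + \<rho>"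
    using int by simp
  also have "(\<integral>x. ?small x \<partial>?J) = (\<integral>S. indicator {S. card S < K} S \<partial>map_pmf fst ?J)"
    unfolding integral_map_pmf ..
  also have "\<dots> = measure_pmf.prob ?S {S. card S < K}"
    unfolding map_fst_pair_pmf by simp
  also have "\<dots> \<le> exp (- (1 / 8) * real K)"
    using K by (intro random_subset_size_lower_tail) auto
  also have "(\<integral>x. ?fail x \<partial>?J) \<le>
      (\<Sum>U | U \<subseteq> {1..N} \<and> card U = K. f U) / real (card {U. U \<subseteq> {1..N} \<and> card U = K})"
    by (rule expectation_shrink_le) (auto simp: f)
  also have "\<dots> = 1 - pdsr_success_prob N K p q \<epsilon> A"
    unfolding f_def using K by (intro pdsr_failure_prob[symmetric]) auto
  finally show ?thesis by simp
qed

text \<open>\<open>\<delta>\<close> bounds the overlap fraction of a successful output from below,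
  \<open>\<gamma>\<close> is chosen so that this overlap raises the expected edge count by at least
  \<open>2 * \<gamma> * K\<^sup>2 * q\<close>, and \<open>m\<close> rounds up the threshold
  \<open>\<gamma> * K\<^sup>2 * q\<close> above the null mean.\<close>

lemma scan_test_error_le:
  fixes \<epsilon> c q :: real and K N :: nat
  defines "\<delta> \<equiv> min 1 (1 - \<epsilon>)"
  defines "\<gamma> \<equiv> \<delta>\<^sup>2 * (c - 1) / 8"
  defines "l \<equiv> \<gamma> / (1 + 4 * \<gamma>)"
  defines "m \<equiv> nat \<lceil>real (K choose 2) * q + \<gamma> * (real K)\<^sup>2 * q\<rceil>"
  assumes \<epsilon>: "\<epsilon> < 1" and c: "c > 1" and q: "0 < q" "c * q \<le> 1" and KN: "2 * K \<le> N"
    and large: "2 \<le> \<delta> * real K" and A: "recovery_alg N K A"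
  shows "pds_error N (2 * K) (c * q) q (run_test N q A (scan_test N m)) \<le>
    (1 - pdsr_success_prob N K (c * q) q \<epsilon> A) + exp (- (1 / 8) * real K) +
    2 * real N * exp (- (l * \<gamma> / 2) * (real K)\<^sup>2 * q + real K * ln (real N))"
proof -
  have \<delta>: "0 < \<delta>" "\<delta> \<le> 1 - \<epsilon>" using \<epsilon> by (auto simp: \<delta>_def)
  have \<gamma>: "0 < \<gamma>" using \<delta> c by (simp add: \<gamma>_def)
  have l: "0 < l" using \<gamma> by (simp add: l_def)
  have K: "0 < K" using large by (cases K) auto
  then have N: "0 < N" using KN by simp
  have qc: "q \<le> c * q" using c q by simp
  then have q1: "q \<le> 1" using q by linarith
  let ?M = "real (K choose 2)"
  let ?a = "?M * q + \<gamma> * (real K)\<^sup>2 * q"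
  let ?B = "exp (- (l * \<gamma> / 2) * (real K)\<^sup>2 * q)"
  let ?Z = "{S. S \<subseteq> {1..N} \<and> card S = K}"
  have M: "0 \<le> ?M" "?M \<le> (real K)\<^sup>2 / 2"
    by simp (simp add: real_choose_two power2_eq_square algebra_simps)
  have a_le: "?a \<le> real n" if "m \<le> n" for n
    using that unfolding m_def by linarith
  have le_a: "real n \<le> ?a" if "n < m" for n
    using that unfolding m_def by linarith
  have finZ: "finite ?Z" by simp
  have union: "real (card ?Z) * ?B \<le> exp (real K * ln (real N)) * ?B"
    using card_K_subsets_le[of N K] N KN by (intro mult_right_mono) auto
  have upper: "measure_pmf.prob (erdos_renyi N q) {G. m \<le> edges_inside S G} \<le> ?B" if S: "S \<in> ?Z" for S
  proof -
    \<comment> \<open>The null law is treated as a planted graph with empty community, so the same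
      Chernoff bound covers both hypotheses.\<close>
    have "measure_pmf.prob (planted_graph N {} q q) {G. m \<le> edges_inside S G} \<le>
      exp ((exp l - 1) * (real (card S choose 2) * q + real (card (S \<inter> {}) choose 2) * (q - q)) - l * ?a)"
      by (rule planted_edges_chernoff) (use q q1 S l a_le in auto)
    also have "\<dots> \<le> ?B"
      using S upper_tail_exponent[OF \<gamma> q(1) M] by (simp add: l_def)
    finally show ?thesis by (simp add: planted_graph_empty)
  qed
  have lower: "measure_pmf.prob (planted_graph N U (c * q) q) {G. edges_inside S G < m} \<le> ?B"
    if S: "S \<in> ?Z" and good: "(1 - \<epsilon>) * real K \<le> real (card (S \<inter> U))" for S U
  proof -
    let ?o = "real (card (S \<inter> U))"
    let ?\<mu> = "?M * q + real (card (S \<inter> U) choose 2) * (c * q - q)"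
    have o: "\<delta> * real K \<le> ?o"
      using \<delta>(2) mult_right_mono[of \<delta> "1 - \<epsilon>" "real K"] good by linarith
    \<comment> \<open>The overlap is at least \<open>\<delta> * K \<ge> 2\<close>, so subtracting
      one vertex at most halves it.\<close>
    have "(\<delta> * real K) * (\<delta> * real K / 2) \<le> ?o * (?o - 1)"
      using o large by (intro mult_mono) auto
    then have "\<delta>\<^sup>2 * (real K)\<^sup>2 / 4 \<le> real (card (S \<inter> U) choose 2)"
      by (simp add: real_choose_two power2_eq_square algebra_simps)
    then have "\<delta>\<^sup>2 * (real K)\<^sup>2 / 4 * (c * q - q) \<le> real (card (S \<inter> U) choose 2) * (c * q - q)"
      using qc by (intro mult_right_mono) auto
    then have \<mu>: "?M * q + 2 * \<gamma> * (real K)\<^sup>2 * q \<le> ?\<mu>"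
      by (simp add: \<gamma>_def field_simps)
    have "measure_pmf.prob (planted_graph N U (c * q) q) {G. edges_inside S G < m} \<le>
      exp ((exp (- l) - 1) * (real (card S choose 2) * q + real (card (S \<inter> U) choose 2) * (c * q - q))
        - (- l) * ?a)"
      by (rule planted_edges_chernoff[OF _ q(2) _ q1]) (use q(1) c S l le_a in auto)
    also have "\<dots> \<le> ?B"
      using S lower_tail_exponent[OF \<gamma> q(1) M \<mu>] by (simp add: l_def)
    finally show ?thesis .
  qed
  let ?E = "exp (real K * ln (real N)) * ?B"
  have "measure_pmf.prob (erdos_renyi N q) {G. \<exists>S\<in>?Z. m \<le> edges_inside S G} \<le> real (card ?Z) * ?B"
    by (rule prob_Ex_le[OF finZ upper])
  from order_trans[OF this union] have type_I: "measure_pmf.prob (erdos_renyi N q)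
      {G. \<exists>S. S \<subseteq> {1..N} \<and> card S = K \<and> m \<le> edges_inside S G} \<le> ?E"
    by (simp only: Bex_def mem_Collect_eq conj_assoc)
  have type_II: "measure_pmf.prob (planted_graph N U (c * q) q)
      {G. \<exists>S. S \<subseteq> {1..N} \<and> card S = K \<and> (1 - \<epsilon>) * real K \<le> real (card (S \<inter> U)) \<and>
        edges_inside S G < m} \<le> ?E" for U
  proof -
    have "measure_pmf.prob (planted_graph N U (c * q) q)
        {G. \<exists>S\<in>?Z. (1 - \<epsilon>) * real K \<le> real (card (S \<inter> U)) \<and> edges_inside S G < m} \<le> real (card ?Z) * ?B"
    proof (rule prob_Ex_le[OF finZ])
      fix S assume "S \<in> ?Z"
      then show "measure_pmf.prob (planted_graph N U (c * q) q)
          {G. (1 - \<epsilon>) * real K \<le> real (card (S \<inter> U)) \<and> edges_inside S G < m} \<le> ?B"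
        using lower[of S U] by (cases "(1 - \<epsilon>) * real K \<le> real (card (S \<inter> U))") auto
    qed
    from order_trans[OF this union] show ?thesis
      by (simp only: Bex_def mem_Collect_eq conj_assoc)
  qed
  have error: "pds_error N (2 * K) (c * q) q (run_test N q A (scan_test N m)) \<le>
    real N * ?E + (exp (- (1 / 8) * real K) + (1 - pdsr_success_prob N K (c * q) q \<epsilon> A) + ?E)"
    unfolding pds_error_scan_test
    by (intro add_mono order_trans[OF scan_test_type_I_le[OF A] mult_left_mono[OF type_I]]
        scan_test_type_II_le A K KN type_II) auto
  \<comment> \<open>The single sparse-set term of the alternative is absorbed into a second copy of
    the \<open>N\<close>-fold null term, whence the factor \<open>2 * N\<close>.\<close>
  have le: "?E \<le> real N * ?E" using N mult_right_mono[of 1 "real N" ?E] by simp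
  have E: "?E = exp (- (l * \<gamma> / 2) * (real K)\<^sup>2 * q + real K * ln (real N))"
    unfolding exp_add by (rule mult.commute)
  show ?thesis
    using error le unfolding E[symmetric] mult.assoc[of 2 "real N"] by linarith
qed

section \<open>The constant test and the choice of \<open>C\<close>\<close>

lemma constant_test:
  "runs_within N (run_test N q A (return_pmf (Answer True))) T"
  "pds_error N K p q (run_test N q A (return_pmf (Answer True))) = 1"
proof -
  have "run_test N q A (return_pmf (Answer True)) = (\<lambda>_. return_pmf (True, 0))"
    by (auto simp: run_test_def bind_return_pmf)
  then show "runs_within N (run_test N q A (return_pmf (Answer True))) T"
    and "pds_error N K p q (run_test N q A (return_pmf (Answer True))) = 1"
    by (auto simp: runs_within_def pds_error_def)
qed

theorem theorem2:
  fixes \<epsilon> c :: real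
  assumes "\<epsilon> < 1" and "c > 1"
  shows "\<exists>C>0. \<forall>(N::nat) (K::nat) (q::real) (T::nat) (\<eta>::real) (A :: (graph, nat set) timed_alg).
    0 < q \<longrightarrow> c * q \<le> 1 \<longrightarrow> 2 * K \<le> N \<longrightarrow>
    recovery_alg N K A \<longrightarrow> runs_within N A T \<longrightarrow>
    pdsr_success_prob N K (c * q) q \<epsilon> A \<ge> 1 - \<eta> \<longrightarrow>
    (\<exists>\<Phi> :: test_prog pmf.
       runs_within N (run_test N q A \<Phi>) (N\<^sup>2 + N * T + N * K\<^sup>2) \<and>
       pds_error N (2 * K) (c * q) q (run_test N q A \<Phi>)
         \<le> \<eta> + exp (- C * real K)
           + 2 * real N * exp (- C * (real K)\<^sup>2 * q + real K * ln (real N)))"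
proof -
  define \<delta> where "\<delta> = min 1 (1 - \<epsilon>)"
  define \<gamma> where "\<gamma> = \<delta>\<^sup>2 * (c - 1) / 8"
  define l where "l = \<gamma> / (1 + 4 * \<gamma>)"
  \<comment> \<open>The three entries come from the community-size tail, the edge-count tails, and
    the case \<open>\<delta> * K < 2\<close>, where the bound must be at least 1.\<close>
  define C where "C = min (1 / 8) (min (l * \<gamma> / 2) (\<delta>\<^sup>2 / 8))"
  have \<delta>: "0 < \<delta>" using assms by (simp add: \<delta>_def)
  then have \<gamma>: "0 < \<gamma>" using assms by (simp add: \<gamma>_def)
  then have "0 < l" by (simp add: l_def)
  then have C: "0 < C" "C \<le> 1 / 8" "C \<le> l * \<gamma> / 2" "C \<le> \<delta>\<^sup>2 / 8"
    using \<delta> \<gamma> by (auto simp: C_def)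
  show ?thesis
  proof (intro exI[of _ C] conjI allI impI C(1))
    fix N K T :: nat and q \<eta> :: real and A :: "(graph, nat set) timed_alg"
    assume q: "0 < q" "c * q \<le> 1" and KN: "2 * K \<le> N" and A: "recovery_alg N K A" "runs_within N A T"
      and succ: "1 - \<eta> \<le> pdsr_success_prob N K (c * q) q \<epsilon> A"
    let ?bound = "\<eta> + exp (- C * real K) + 2 * real N * exp (- C * (real K)\<^sup>2 * q + real K * ln (real N))"
    have "pdsr_success_prob N K (c * q) q \<epsilon> A \<le> 1" by (simp add: pdsr_success_prob_def)
    then have \<eta>: "0 \<le> \<eta>" using succ by simp
    show "\<exists>\<Phi>. runs_within N (run_test N q A \<Phi>) (N\<^sup>2 + N * T + N * K\<^sup>2) \<and>
       pds_error N (2 * K) (c * q) q (run_test N q A \<Phi>) \<le> ?bound"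
    proof (cases "2 \<le> \<delta> * real K")
      case True
      let ?\<Phi> = "scan_test N (nat \<lceil>real (K choose 2) * q + \<gamma> * (real K)\<^sup>2 * q\<rceil>)"
      have "pds_error N (2 * K) (c * q) q (run_test N q A ?\<Phi>) \<le>
          (1 - pdsr_success_prob N K (c * q) q \<epsilon> A) + exp (- (1 / 8) * real K) +
          2 * real N * exp (- (l * \<gamma> / 2) * (real K)\<^sup>2 * q + real K * ln (real N))"
        using scan_test_error_le[OF assms q KN True[unfolded \<delta>_def] A(1)]
        unfolding \<delta>_def[symmetric] \<gamma>_def[symmetric] l_def[symmetric] .
      also have "\<dots> \<le> ?bound"
      proof -
        have "C * real K \<le> 1 / 8 * real K" "C * ((real K)\<^sup>2 * q) \<le> l * \<gamma> / 2 * ((real K)\<^sup>2 * q)"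
          using C q by (intro mult_right_mono; simp)+
        then show ?thesis
          using succ by (intro add_mono mult_left_mono exp_le_cancel_iff[THEN iffD2]) (auto simp: mult.assoc)
      qed
      finally show ?thesis using runs_within_scan_test[OF A] by blast
    next
      case False
      have "1 \<le> ?bound"
      \<comment> \<open>For \<open>K = 0\<close> the term \<open>exp (- C * K)\<close> is already
        1.\<close>
      proof (cases "K = 0")
        case False
        then have N: "1 \<le> real N" using KN by simp
        have "c * q \<ge> q" using assms q by simp
        then have q1: "q \<le> 1" using q by linarith
        \<comment> \<open>Since \<open>\<delta> * K < 2\<close>, the negative exponent is at most
          \<open>1/2\<close> in absolute value, so the exponential is at least \<open>1/2\<close>
          and the factor \<open>2 * N\<close> lifts the last term to 1.\<close>
        have "C * (real K)\<^sup>2 * q \<le> \<delta>\<^sup>2 / 8 * (real K)\<^sup>2 * 1"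
          using C q q1 by (intro mult_mono) auto
        also have "\<dots> = (\<delta> * real K)\<^sup>2 / 8" by (simp add: power_mult_distrib)
        also have "\<dots> \<le> 2\<^sup>2 / 8"
          using \<open>\<not> 2 \<le> \<delta> * real K\<close> \<delta> by (intro divide_right_mono power_mono) auto
        finally have "1 / 2 \<le> 1 + (- C * (real K)\<^sup>2 * q)" by simp
        also have "\<dots> \<le> exp (- C * (real K)\<^sup>2 * q)" by (rule exp_ge_add_one_self)
        also have "\<dots> \<le> exp (- C * (real K)\<^sup>2 * q + real K * ln (real N))" using N by simp
        finally have "2 * 1 * (1 / 2) \<le> 2 * real N * exp (- C * (real K)\<^sup>2 * q + real K * ln (real N))"
          using N by (intro mult_mono) auto
        then show ?thesis using \<eta> by (simp add: add_increasing)
      qed (use \<eta> in simp)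
      then show ?thesis
        by (intro exI[of _ "return_pmf (Answer True)"]) (simp add: constant_test)
    qed
  qed
qed

end
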